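(* Let $F$ be a complex sequence satisfying a linear recurrence with constant coefficients of minimal order $d$ whose characteristic roots $r_1,\dots,r_d$ are distinct (and nonzero), and let $p$ and $q$ be distinct positive integers. Let $\mathbf{V}$ be the space of complex functions on $\{0,1,2,\dots\}$. Let $\mathbf{W}_p$ be the subspace spanned by all functions $n\mapsto F(n)^{i_1}F(n+1)^{i_2}\cdots F(n+d-1)^{i_d}$ with $i_j\ge0$, $\sum_ji_j=p$; let $\mathbf{W}_q^+$ be the subspace spanned by all functions $n\mapsto F(n)^{i_1}\cdots F(n+d-1)^{i_d}$ and $n\mapsto nF(n)^{i_1}\cdots F(n+d-1)^{i_d}$ with $i_j\ge0$, $\sum_ji_j=q$; and let $\mathbf{W}_{p,q}^{++}=\mathbf{W}_p+\mathbf{W}_q^+$. Let $S_p=\{r_1^{i_1}\cdots r_d^{i_d}: i_j\ge0,\ \sum i_j=p\}$ and $S_q=\{r_1^{i_1}\cdots r_d^{i_d}: i_j\ge0,\ \sum i_j=q\}$, regarded as sets of complex numbers. Then $$\dim\mathbf{W}_p=|S_p|,\qquad\dim\mathbf{W}_q^+=2|S_q|,\qquad\dim\mathbf{W}_{p,q}^{++}=|S_p|+2|S_q|-|S_p\cap S_q|.$$ *)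

theory Defs
  imports
    Complex_Main
    "HOL-Library.Function_Algebras"
    "HOL-Library.Set_Algebras"
    "HOL-Computational_Algebra.Polynomial"
begin

definition seq_scale :: "complex \<Rightarrow> (nat \<Rightarrow> complex) \<Rightarrow> nat \<Rightarrow> complex" where
  "seq_scale a f = (\<lambda>n. a * f n)"

global_interpretation seq: vector_space seq_scale
  by unfold_locales (auto simp: seq_scale_def fun_eq_iff algebra_simps)

definition satisfies_recurrence ::
    "(nat \<Rightarrow> complex) \<Rightarrow> nat \<Rightarrow> (nat \<Rightarrow> complex) \<Rightarrow> bool" where
  "satisfies_recurrence F d c \<longleftrightarrow> (\<forall>n. F (n + d) = (\<Sum>k<d. c k * F (n + k)))"

definition minimal_recurrence ::
    "(nat \<Rightarrow> complex) \<Rightarrow> nat \<Rightarrow> (nat \<Rightarrow> complex) \<Rightarrow> bool" where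
  "minimal_recurrence F d c \<longleftrightarrow>
     satisfies_recurrence F d c \<and> (\<forall>e<d. \<nexists>c'. satisfies_recurrence F e c')"

definition characteristic_poly :: "nat \<Rightarrow> (nat \<Rightarrow> complex) \<Rightarrow> complex poly" where
  "characteristic_poly d c = monom 1 d - (\<Sum>k<d. monom (c k) k)"

text \<open>Indices run over \<open>0, \<dots>, d - 1\<close>: the root \<open>r j\<close> and the exponent \<open>i j\<close> stand for the
  conventional \<open>r\<^sub>j\<^sub>+\<^sub>1\<close> and \<open>i\<^sub>j\<^sub>+\<^sub>1\<close>. Values of exponent functions outside
  \<open>{..<d}\<close> are irrelevant.\<close>

definition shift_monomial :: "(nat \<Rightarrow> complex) \<Rightarrow> nat \<Rightarrow> (nat \<Rightarrow> nat) \<Rightarrow> nat \<Rightarrow> complex" where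
  "shift_monomial F d i = (\<lambda>n. \<Prod>j<d. F (n + j) ^ i j)"

definition W :: "(nat \<Rightarrow> complex) \<Rightarrow> nat \<Rightarrow> nat \<Rightarrow> (nat \<Rightarrow> complex) set" where
  "W F d p = seq.span {shift_monomial F d i | i. (\<Sum>j<d. i j) = p}"

definition W_plus :: "(nat \<Rightarrow> complex) \<Rightarrow> nat \<Rightarrow> nat \<Rightarrow> (nat \<Rightarrow> complex) set" where
  "W_plus F d q = seq.span
     ({shift_monomial F d i | i. (\<Sum>j<d. i j) = q} \<union>
      {(\<lambda>n. of_nat n * shift_monomial F d i n) | i. (\<Sum>j<d. i j) = q})"

definition W_plus_plus ::
    "(nat \<Rightarrow> complex) \<Rightarrow> nat \<Rightarrow> nat \<Rightarrow> nat \<Rightarrow> (nat \<Rightarrow> complex) set" where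
  "W_plus_plus F d p q = W F d p + W_plus F d q"

definition root_products :: "(nat \<Rightarrow> complex) \<Rightarrow> nat \<Rightarrow> nat \<Rightarrow> complex set" where
  "root_products r d p = {(\<Prod>j<d. r j ^ i j) | i. (\<Sum>j<d. i j) = p}"

end

theory Submission
  imports Defs
begin

text \<open>
  By minimality, the shifts \<open>F, EF, \<dots>, E\<^sup>d\<^sup>-\<^sup>1F\<close> span the same space as the geometric sequences
  \<open>n \<mapsto> r\<^sub>j\<^sup>n\<close>: applying the operator \<open>\<Prod>\<^sub>i\<^sub>\<noteq>\<^sub>j (E - r\<^sub>i)\<close> to \<open>F\<close> yields a nonzero multiple of
  \<open>n \<mapsto> r\<^sub>j\<^sup>n\<close>, and these \<open>d\<close> sequences are independent. Hence the degree \<open>p\<close> monomials in the shifts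
  span the same space as the degree \<open>p\<close> monomials in the geometric sequences, and the latter are
  the sequences \<open>n \<mapsto> x\<^sup>n\<close> with \<open>x \<in> S\<^sub>p\<close>. Everything thus reduces to the linear independence of
  the sequences \<open>n \<mapsto> x\<^sup>n\<close> and \<open>n \<mapsto> n x\<^sup>n\<close>, which is witnessed by the dual functionals
  \<open>f \<mapsto> \<Sum>\<^sub>i coeff P i * f i\<close> for suitable polynomials \<open>P\<close>: they send these sequences to \<open>P x\<close> and
  \<open>x P' x\<close>.
\<close>

section \<open>Monomials as powers of sets\<close>

text \<open>The power is elementwise multiplication of sets, so monomials of degree \<open>p\<close>
  become accessible to induction on \<open>p\<close>: one more factor \<open>f k\<close> raises the
  exponent at \<open>k\<close> by one.\<close>

lemma image_power_eq_monomials: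
  fixes f :: "'a \<Rightarrow> 'b :: comm_monoid_mult"
  assumes "finite J"
  shows "(f ` J) ^ p = {(\<Prod>j\<in>J. f j ^ i j) | i. (\<Sum>j\<in>J. i j) = p}"
proof (induction p)
  case 0
  have "(\<Prod>j\<in>J. f j ^ i j) = 1" if "(\<Sum>j\<in>J. i j) = 0" for i :: "'a \<Rightarrow> nat"
    using that assms by simp
  moreover have "\<exists>i :: 'a \<Rightarrow> nat. (\<Sum>j\<in>J. i j) = 0"
    by (rule exI[of _ "\<lambda>_. 0"]) simp
  ultimately show ?case
    by (auto simp: set_one) metis
next
  case (Suc p)
  show ?case
  proof (intro equalityI subsetI)
    fix x assume "x \<in> (f ` J) ^ Suc p"
    then obtain k i where k: "k \<in> J" and i: "(\<Sum>j\<in>J. i j) = p"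
      and x: "x = f k * (\<Prod>j\<in>J. f j ^ i j)"
      unfolding power_Suc Suc.IH by (auto simp: set_times_def)
    let ?i = "i(k := Suc (i k))"
    have "(\<Sum>j\<in>J. ?i j) = Suc p"
      using i k assms by (simp add: sum.remove)
    moreover have "x = (\<Prod>j\<in>J. f j ^ ?i j)"
      using x k assms by (simp add: prod.remove mult.assoc)
    ultimately show "x \<in> {(\<Prod>j\<in>J. f j ^ i j) | i. (\<Sum>j\<in>J. i j) = Suc p}"
      by blast
  next
    fix x assume "x \<in> {(\<Prod>j\<in>J. f j ^ i j) | i. (\<Sum>j\<in>J. i j) = Suc p}"
    then obtain i where i: "(\<Sum>j\<in>J. i j) = Suc p" and x: "x = (\<Prod>j\<in>J. f j ^ i j)"
      by blast
    from i assms obtain k where k: "k \<in> J" "i k > 0"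
      by (metis gr0I sum.neutral nat.distinct(1))
    let ?i = "i(k := i k - 1)"
    have "(\<Sum>j\<in>J. ?i j) = p"
      using i k assms by (simp add: sum.remove)
    moreover have "x = f k * (\<Prod>j\<in>J. f j ^ ?i j)"
      using x k assms by (simp add: prod.remove mult.assoc[symmetric] power_Suc[symmetric] del: power_Suc)
    ultimately show "x \<in> (f ` J) ^ Suc p"
      unfolding power_Suc Suc.IH using k by (auto simp: set_times_def)
  qed
qed

text \<open>Meant for \<open>geometric\<close>, which is multiplicative: degree \<open>p\<close>
  monomials in the sequences \<open>geometric (r j)\<close> are the geometric sequences of the
  degree \<open>p\<close> products of roots.\<close>

lemma image_power_hom:
  fixes f :: "'a :: comm_monoid_mult \<Rightarrow> 'b :: comm_monoid_mult"
  assumes "f 1 = 1" and "\<And>x y. f (x * y) = f x * f y"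
  shows "f ` (A ^ p) = (f ` A) ^ p"
proof (induction p)
  case 0
  show ?case by (simp add: set_one assms)
next
  case (Suc p)
  have "f ` (A * A ^ p) = f ` A * f ` (A ^ p)"
    by (force simp: set_times_def assms)
  with Suc show ?case by simp
qed

lemma power_fun_apply: "(f ^ n) x = f x ^ n" for f :: "'a \<Rightarrow> 'b :: monoid_mult"
  by (induction n) auto

lemma prod_fun_apply:
  "(\<Prod>j\<in>J. f j) x = (\<Prod>j\<in>J. f j x)" for f :: "'c \<Rightarrow> 'a \<Rightarrow> 'b :: comm_monoid_mult"
  by (induction J rule: infinite_finite_induct) auto

section \<open>Spans of products\<close>

lemma seq_scale_mult:
  "seq_scale a f * g = seq_scale a (f * g)" "f * seq_scale a g = seq_scale a (f * g)"
  by (auto simp: seq_scale_def fun_eq_iff)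

lemma span_times_right:
  assumes "\<And>b. b \<in> B \<Longrightarrow> a * b \<in> seq.span C" and "g \<in> seq.span B"
  shows "a * g \<in> seq.span C"
  using assms(2)
proof (induction rule: seq.span_induct_alt)
  case base
  have "a * 0 = 0" by (simp add: fun_eq_iff)
  then show ?case by (metis seq.span_zero)
next
  case (step c x y)
  have "a * (seq_scale c x + y) = seq_scale c (a * x) + a * y"
    by (simp only: distrib_left seq_scale_mult)
  with step show ?case
    by (metis assms(1) seq.span_add seq.span_scale)
qed

text \<open>The pointwise product is bilinear, so the generators on one side can be replaced by span
  elements, then those on the other.\<close>

lemma span_times:
  assumes "A \<subseteq> seq.span A'" and "B \<subseteq> seq.span B'"
  shows "A * B \<subseteq> seq.span (A' * B')"
proof
  fix x assume "x \<in> A * B"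
  then obtain f g where x: "x = f * g" and f: "f \<in> seq.span A'" and g: "g \<in> seq.span B'"
    using assms by (auto simp: set_times_def)
  have "a * g \<in> seq.span (A' * B')" if "a \<in> A'" for a
    by (rule span_times_right[OF _ g]) (use that in \<open>auto intro: seq.span_base\<close>)
  then have "g * f \<in> seq.span (A' * B')"
    by (intro span_times_right[OF _ f]) (simp add: mult.commute)
  then show "x \<in> seq.span (A' * B')"
    by (simp add: x mult.commute)
qed

lemma span_times_cong:
  assumes "seq.span A = seq.span A'" and "seq.span B = seq.span B'"
  shows "seq.span (A * B) = seq.span (A' * B')"
  unfolding seq.span_eq
  using span_times[of A A' B B'] span_times[of A' A B' B] assms seq.span_superset by blast

lemma span_power_cong:
  assumes "seq.span A = seq.span B"
  shows "seq.span (A ^ p) = seq.span (B ^ p)"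
proof (induction p)
  case (Suc p)
  then show ?case
    unfolding power_Suc by (rule span_times_cong[OF assms])
qed simp

section \<open>Polynomials as functionals on sequences\<close>

text \<open>With E the shift operator, this is the value at 0 of P(E) f; hence
  \<open>poly_functional P (shift n f)\<close> is its value at n.\<close>

definition poly_functional :: "complex poly \<Rightarrow> (nat \<Rightarrow> complex) \<Rightarrow> complex" where
  "poly_functional P f = (\<Sum>i\<le>degree P. coeff P i * f i)"

definition geometric :: "complex \<Rightarrow> nat \<Rightarrow> complex" where
  "geometric x = (\<lambda>n. x ^ n)"

definition shift :: "nat \<Rightarrow> (nat \<Rightarrow> complex) \<Rightarrow> nat \<Rightarrow> complex" where
  "shift k f = (\<lambda>n. f (n + k))"

lemma poly_functional_eq_sum:
  assumes "degree P \<le> N"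
  shows "poly_functional P f = (\<Sum>i\<le>N. coeff P i * f i)"
  unfolding poly_functional_def using assms
  by (intro sum.mono_neutral_left) (auto simp: coeff_eq_0)

lemma poly_functional_pCons:
  "poly_functional (pCons a P) f = a * f 0 + poly_functional P (shift 1 f)"
proof -
  have "poly_functional (pCons a P) f = (\<Sum>i\<le>Suc (degree P). coeff (pCons a P) i * f i)"
    by (intro poly_functional_eq_sum degree_pCons_le)
  also have "\<dots> = a * f 0 + poly_functional P (shift 1 f)"
    unfolding sum.atMost_Suc_shift by (simp add: poly_functional_def shift_def)
  finally show ?thesis .
qed

lemma poly_functional_zero: "poly_functional 0 f = 0"
  by (simp add: poly_functional_def)

lemma poly_functional_add:
  "poly_functional (P + Q) f = poly_functional P f + poly_functional Q f"
  using poly_functional_eq_sum[of P "max (degree P) (degree Q)"]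
    poly_functional_eq_sum[of Q "max (degree P) (degree Q)"]
    poly_functional_eq_sum[of "P + Q" "max (degree P) (degree Q)"]
  by (simp add: degree_add_le distrib_right sum.distrib)

lemma poly_functional_smult: "poly_functional (smult a P) f = a * poly_functional P f"
  using poly_functional_eq_sum[of "smult a P" "degree P" f]
  by (simp add: degree_smult_le poly_functional_def sum_distrib_left mult.assoc)

lemma poly_functional_linear_mult:
  "poly_functional ([:- a, 1:] * P) f = poly_functional P (shift 1 f) - a * poly_functional P f"
  by (simp add: poly_functional_add poly_functional_smult poly_functional_pCons
      poly_functional_zero flip: smult_minus_left)

lemma poly_functional_geometric: "poly_functional P (geometric x) = poly P x"
  by (simp add: poly_functional_def geometric_def poly_altdef)

text \<open>Induction on \<open>P\<close>: shifting n x^n gives x (n x^n) + x x^n, which mirrors the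
  product rule (X P)' = P + X P'.\<close>

lemma poly_functional_of_nat_geometric:
  "poly_functional P (of_nat * geometric x) = x * poly (pderiv P) x"
proof (induction P)
  case 0
  show ?case by (simp add: poly_functional_zero)
next
  case (pCons a P)
  have "shift 1 (of_nat * geometric x) =
      (\<lambda>n. x * (of_nat * geometric x) n + x * geometric x n)"
    by (simp add: shift_def geometric_def fun_eq_iff algebra_simps)
  then have "poly_functional P (shift 1 (of_nat * geometric x)) =
      x * poly_functional P (of_nat * geometric x) + x * poly_functional P (geometric x)"
    by (simp add: poly_functional_def sum_distrib_left sum.distrib distrib_left mult.left_commute)
  moreover have "(of_nat * geometric x) 0 = 0" by simp
  ultimately show ?case
    unfolding poly_functional_pCons poly_functional_geometric pderiv_pCons pCons.IH
    by (simp add: distrib_left del: times_fun_apply)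
qed

lemma poly_functional_eq_0_on_span:
  assumes "\<And>f. f \<in> A \<Longrightarrow> poly_functional P f = 0" and "g \<in> seq.span A"
  shows "poly_functional P g = 0"
  using assms(2)
proof (induction rule: seq.span_induct_alt)
  case base
  show ?case by (simp add: poly_functional_def)
next
  case (step c x y)
  have "poly_functional P (seq_scale c x + y) = c * poly_functional P x + poly_functional P y"
    by (simp add: poly_functional_def seq_scale_def sum_distrib_left sum.distrib
        distrib_left mult.left_commute)
  with step assms(1) show ?case by (simp del: plus_fun_apply)
qed

section \<open>Independence of geometric sequences\<close>

text \<open>Keeping the bases of x^n and of n y^n as separate sets lets one dimension formula serve
  all three spaces.\<close>

definition exponential_family :: "complex set \<Rightarrow> complex set \<Rightarrow> (nat \<Rightarrow> complex) set" where
  "exponential_family X Y = geometric ` X \<union> (\<lambda>y. of_nat * geometric y) ` Y"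

lemma inj_geometric: "inj geometric"
  by (rule injI) (metis geometric_def power_one_right)

lemma inj_of_nat_geometric: "inj (\<lambda>y. of_nat * geometric y)"
proof (rule injI)
  fix x y :: complex
  assume "of_nat * geometric x = of_nat * geometric y"
  from fun_cong[OF this, of 1] show "x = y" by (simp add: geometric_def)
qed

lemma geometric_neq: "geometric x \<noteq> of_nat * geometric y"
proof
  assume "geometric x = of_nat * geometric y"
  from fun_cong[OF this, of 0] show False by (simp add: geometric_def)
qed

lemma card_exponential_family:
  assumes "finite X" and "finite Y"
  shows "card (exponential_family X Y) = card X + card Y"
  unfolding exponential_family_def using assms inj_geometric inj_of_nat_geometric geometric_neq
  by (subst card_Un_disjoint) (auto simp: card_image inj_on_subset)

text \<open>A squared product of linear factors vanishes to second order on \<open>Z - {x}\<close>;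
  a linear factor then cancels its derivative at \<open>x\<close>.\<close>

lemma hermite_value:
  fixes x :: complex
  assumes "finite Z"
  obtains P where "poly P x \<noteq> 0" and "poly (pderiv P) x = 0"
    and "\<And>z. z \<in> Z - {x} \<Longrightarrow> poly P z = 0 \<and> poly (pderiv P) z = 0"
proof -
  define Q where "Q = (\<Prod>z\<in>Z - {x}. [:- z, 1:]) ^ 2"
  define a where "a = poly (pderiv Q) x / poly Q x"
  \<comment> \<open>As a polynomial in t this is 1 - a (t - x), so (Q L)'(x) = Q'(x) - a Q(x) =
    0.\<close>
  define L where "L = [:1 + a * x, - a:]"
  have L: "poly L x = 1" "poly (pderiv L) x = - a"
    by (simp_all add: L_def pderiv_pCons)
  have Qx: "poly Q x \<noteq> 0"
    using assms by (auto simp: Q_def poly_prod)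
  have Qz: "poly Q z = 0 \<and> poly (pderiv Q) z = 0" if "z \<in> Z - {x}" for z
  proof -
    have "poly (\<Prod>z\<in>Z - {x}. [:- z, 1:]) z = 0"
      using assms that by (force simp: poly_prod)
    then show ?thesis by (simp add: Q_def power2_eq_square pderiv_mult)
  qed
  show thesis
    by (rule that[of "Q * L"]) (use Qx Qz L in \<open>auto simp: pderiv_mult a_def\<close>)
qed

text \<open>The factor t - x kills the value at \<open>x\<close> and leaves Q(x), which is nonzero,
  as the derivative there.\<close>

lemma hermite_derivative:
  fixes x :: complex
  assumes "finite Z"
  obtains P where "poly P x = 0" and "poly (pderiv P) x \<noteq> 0"
    and "\<And>z. z \<in> Z - {x} \<Longrightarrow> poly P z = 0 \<and> poly (pderiv P) z = 0"
proof -
  obtain Q where Q: "poly Q x \<noteq> 0"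
    "\<And>z. z \<in> Z - {x} \<Longrightarrow> poly Q z = 0 \<and> poly (pderiv Q) z = 0"
    using hermite_value[OF assms] by metis
  show thesis
    by (rule that[of "[:- x, 1:] * Q"])
      (use Q in \<open>auto simp: pderiv_mult pderiv_pCons simp del: mult_pCons_left\<close>)
qed

text \<open>Each member has a functional that is nonzero on it and zero on all the others, hence on
  their span. For y = 0 the sequence n y^n would vanish identically.\<close>

lemma independent_exponential_family:
  assumes "finite X" and "finite Y" and "0 \<notin> Y"
  shows "seq.independent (exponential_family X Y)"
proof -
  let ?B = "exponential_family X Y"
  have fin: "finite (X \<union> Y)" using assms by simp
  have "\<exists>P. poly_functional P b \<noteq> 0 \<and> (\<forall>f \<in> ?B - {b}. poly_functional P f = 0)"
    if b: "b \<in> ?B" for b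
  proof -
    consider x where "b = geometric x" | y where "y \<in> Y" "b = of_nat * geometric y"
      using b by (auto simp: exponential_family_def)
    then show ?thesis
    proof cases
      case (1 x)
      obtain P where P: "poly P x \<noteq> 0" "poly (pderiv P) x = 0"
        "\<And>z. z \<in> X \<union> Y - {x} \<Longrightarrow> poly P z = 0 \<and> poly (pderiv P) z = 0"
        using hermite_value[OF fin] by metis
      have "poly_functional P f = 0" if "f \<in> ?B - {b}" for f
        using that P 1 by (force simp: exponential_family_def poly_functional_geometric
            poly_functional_of_nat_geometric)
      moreover have "poly_functional P b \<noteq> 0"
        by (simp add: 1 P poly_functional_geometric)
      ultimately show ?thesis by blast
    next
      case (2 y)
      obtain P where P: "poly P y = 0" "poly (pderiv P) y \<noteq> 0"
        "\<And>z. z \<in> X \<union> Y - {y} \<Longrightarrow> poly P z = 0 \<and> poly (pderiv P) z = 0"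
        using hermite_derivative[OF fin] by metis
      have "poly_functional P f = 0" if "f \<in> ?B - {b}" for f
        using that P 2 by (force simp: exponential_family_def poly_functional_geometric
            poly_functional_of_nat_geometric)
      moreover have "poly_functional P b \<noteq> 0"
        using 2 P assms by (auto simp: poly_functional_of_nat_geometric)
      ultimately show ?thesis by blast
    qed
  qed
  then show ?thesis
    unfolding seq.dependent_def by (metis poly_functional_eq_0_on_span)
qed

lemma dim_span_exponential_family:
  assumes "finite X" and "finite Y" and "0 \<notin> Y"
  shows "seq.dim (seq.span (exponential_family X Y)) = card X + card Y"
  using assms
  by (simp add: seq.dim_span_eq_card_independent independent_exponential_family
      card_exponential_family del: seq.dim_span)

section \<open>The span of the shifts\<close>

lemma recurrence_imp_poly_functional:
  assumes "satisfies_recurrence F d c"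
  shows "poly_functional (characteristic_poly d c) (shift n F) = 0"
proof -
  have "degree (characteristic_poly d c) \<le> d"
    unfolding characteristic_poly_def
    by (intro degree_diff_le degree_sum_le degree_monom_le)
      (auto intro: order_trans[OF degree_monom_le])
  then have "poly_functional (characteristic_poly d c) (shift n F) =
      (\<Sum>i\<le>d. coeff (characteristic_poly d c) i * F (i + n))"
    by (simp add: poly_functional_eq_sum shift_def)
  also have "\<dots> = F (d + n) + (\<Sum>i<d. coeff (characteristic_poly d c) i * F (i + n))"
    by (simp add: characteristic_poly_def coeff_sum add.commute flip: lessThan_Suc_atMost)
  also have "(\<Sum>i<d. coeff (characteristic_poly d c) i * F (i + n)) =
      (\<Sum>i<d. - (c i * F (n + i)))"
    by (intro sum.cong) (auto simp: characteristic_poly_def coeff_sum add.commute)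
  finally show ?thesis
    using assms by (simp add: satisfies_recurrence_def sum_negf add.commute[of d n])
qed

text \<open>A monic annihilator of \<open>F\<close> is a recurrence whose order is its degree; an
  annihilator of degree below \<open>d\<close> will contradict minimality.\<close>

lemma poly_functional_imp_recurrence:
  assumes "degree P = e" and "lead_coeff P = 1"
    and "\<And>n. poly_functional P (shift n F) = 0"
  shows "satisfies_recurrence F e (\<lambda>k. - coeff P k)"
  unfolding satisfies_recurrence_def
proof
  fix n
  show "F (n + e) = (\<Sum>k<e. - coeff P k * F (n + k))"
    using assms(3)[of n] assms(1,2)
    by (simp add: poly_functional_def shift_def sum_negf add.commute eq_neg_iff_add_eq_0
        flip: lessThan_Suc_atMost)
qed

lemma geometric_in_span_shifts:
  assumes min: "minimal_recurrence F d c"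
    and char: "characteristic_poly d c = (\<Prod>j<d. [:- r j, 1:])"
    and j: "j < d"
  shows "geometric (r j) \<in> seq.span ((\<lambda>k. shift k F) ` {..<d})"
proof -
  define P where "P = (\<Prod>i\<in>{..<d} - {j}. [:- r i, 1:])"
  \<comment> \<open>G = P(E) F is annihilated by E - r_j, since (X - r_j) P is the characteristic
    polynomial; hence it is geometric.\<close>
  define G where "G n = poly_functional P (shift n F)" for n
  have P: "characteristic_poly d c = [:- r j, 1:] * P"
    unfolding char P_def using j by (subst prod.remove[of _ j]) auto
  have "degree P = card ({..<d} - {j})"
    unfolding P_def by (subst degree_prod_eq_sum_degree) auto
  then have deg: "degree P = d - 1" using j by simp
  have lead: "lead_coeff P = 1"
    unfolding P_def by (simp add: lead_coeff_prod)
  have "G (Suc n) = r j * G n" for n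
  proof -
    have "shift 1 (shift n F) = shift (Suc n) F"
      by (simp add: shift_def fun_eq_iff)
    then show ?thesis
      using recurrence_imp_poly_functional[of F d c n] min
      unfolding minimal_recurrence_def P poly_functional_linear_mult by (simp add: G_def)
  qed
  then have G: "G n = G 0 * r j ^ n" for n
    by (induction n) auto
  \<comment> \<open>Otherwise G vanishes identically and \<open>P\<close> yields a recurrence of
    order d - 1.\<close>
  have "G 0 \<noteq> 0"
  proof
    assume "G 0 = 0"
    then have "satisfies_recurrence F (d - 1) (\<lambda>k. - coeff P k)"
      using G by (intro poly_functional_imp_recurrence deg lead) (metis G_def mult_zero_left)
    with min j show False
      unfolding minimal_recurrence_def by (metis diff_less less_one gr0I not_less0)
  qed
  have geometric: "geometric (r j) = seq_scale (1 / G 0) G"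
  proof
    fix n
    show "geometric (r j) n = seq_scale (1 / G 0) G n"
      unfolding geometric_def seq_scale_def using G[of n] \<open>G 0 \<noteq> 0\<close> by simp
  qed
  \<comment> \<open>Since \<open>P\<close> has degree d - 1, only the shifts with k < d
    occur.\<close>
  have "G = (\<Sum>k\<le>d - 1. seq_scale (coeff P k) (shift k F))"
  proof
    fix n
    have "(\<Sum>k\<in>K. seq_scale (coeff P k) (shift k F)) n = (\<Sum>k\<in>K. coeff P k * F (n + k))"
      for K :: "nat set"
      by (induction K rule: infinite_finite_induct) (auto simp: seq_scale_def shift_def)
    then show "G n = (\<Sum>k\<le>d - 1. seq_scale (coeff P k) (shift k F)) n"
      by (simp add: G_def poly_functional_def deg shift_def add.commute)
  qed
  also have "\<dots> \<in> seq.span ((\<lambda>k. shift k F) ` {..<d})"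
    using j by (intro seq.span_sum seq.span_scale seq.span_base) auto
  finally show ?thesis
    unfolding geometric by (rule seq.span_scale)
qed

lemma span_shifts_eq:
  assumes min: "minimal_recurrence F d c"
    and char: "characteristic_poly d c = (\<Prod>j<d. [:- r j, 1:])"
    and inj: "inj_on r {..<d}"
  shows "seq.span ((\<lambda>k. shift k F) ` {..<d}) = seq.span (geometric ` r ` {..<d})"
proof -
  let ?A = "(\<lambda>k. shift k F) ` {..<d}" and ?B = "geometric ` r ` {..<d}"
  have B: "?B = exponential_family (r ` {..<d}) {}"
    by (simp add: exponential_family_def)
  have ind: "seq.independent ?B"
    unfolding B by (rule independent_exponential_family) auto
  have card: "card ?B = d"
    unfolding B using inj by (subst card_exponential_family) (auto simp: card_image)
  have sub: "?B \<subseteq> seq.span ?A"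
    using geometric_in_span_shifts[OF min char] by auto
  \<comment> \<open>Dimension count: a shift outside the span of \<open>?B\<close> would give d + 1
    independent sequences in a space spanned by at most d.\<close>
  have "?A \<subseteq> seq.span ?B"
  proof (rule ccontr)
    assume "\<not> ?A \<subseteq> seq.span ?B"
    then obtain a where a: "a \<in> ?A" "a \<notin> seq.span ?B" by blast
    have "insert a ?B \<subseteq> seq.span ?A"
      using sub seq.span_base[OF a(1)] by (rule insert_subsetI[rotated])
    moreover have "seq.independent (insert a ?B)"
      unfolding seq.independent_insert using a(2) ind by presburger
    ultimately have "card (insert a ?B) \<le> card ?A"
      by (metis finite_imageI finite_lessThan seq.independent_span_bound)
    also have "\<dots> \<le> d"
      by (metis card_image_le card_lessThan finite_lessThan)
    also have "d < card (insert a ?B)"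
    proof -
      have "a \<notin> ?B" by (rule contra_subsetD[OF seq.span_superset a(2)])
      moreover have "finite ?B" by simp
      ultimately have "card (insert a ?B) = Suc (card ?B)" by (rule card_insert_disjoint[rotated])
      then show ?thesis unfolding card by simp
    qed
    finally show False by simp
  qed
  with sub show ?thesis
    unfolding seq.span_eq by (rule conjI[rotated])
qed

section \<open>Bases and dimensions of the three spaces\<close>

theorem theorem7:
  fixes F c r :: "nat \<Rightarrow> complex" and d p q :: nat
  assumes "minimal_recurrence F d c"
    and "characteristic_poly d c = (\<Prod>j<d. [:- r j, 1:])"
    and "inj_on r {..<d}"
    and "\<And>j. j < d \<Longrightarrow> r j \<noteq> 0"
    and "p > 0" and "q > 0" and "p \<noteq> q"
  shows "seq.dim (W F d p) = card (root_products r d p) \<and>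
    seq.dim (W_plus F d q) = 2 * card (root_products r d q) \<and>
    int (seq.dim (W_plus_plus F d p q)) =
      int (card (root_products r d p)) + 2 * int (card (root_products r d q))
        - int (card (root_products r d p \<inter> root_products r d q))"
proof -
  let ?A = "(\<lambda>k. shift k F) ` {..<d}" and ?S = "root_products r d"
  have S: "?S m = (r ` {..<d}) ^ m" for m
    by (simp add: root_products_def image_power_eq_monomials)
  have finS: "finite (?S m)" for m
    unfolding S by (induction m) (simp_all add: set_one finite_set_times)
  \<comment> \<open>Nonzero roots have nonzero products, as independence of the sequences n x^n
    requires.\<close>
  have nz: "0 \<notin> ?S m" for m
    using assms(4) by (auto simp: root_products_def)
  have monom: "{shift_monomial F d i | i. (\<Sum>j<d. i j) = m} = ?A ^ m" for m
  proof -
    have "shift_monomial F d i = (\<Prod>j<d. shift j F ^ i j)" for i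
      by (simp add: shift_monomial_def fun_eq_iff prod_fun_apply power_fun_apply shift_def)
    then show ?thesis by (simp add: image_power_eq_monomials)
  qed
  have "seq.span (?A ^ m) = seq.span ((geometric ` r ` {..<d}) ^ m)" for m
    by (rule span_power_cong[OF span_shifts_eq[OF assms(1-3)]])
  then have span: "seq.span (?A ^ m) = seq.span (geometric ` ?S m)" for m
    unfolding S
    by (subst image_power_hom) (auto simp: geometric_def fun_eq_iff power_mult_distrib)
  have "W F d p = seq.span (?A ^ p)"
    by (simp only: W_def monom)
  then have W: "W F d p = seq.span (exponential_family (?S p) {})"
    by (simp add: span exponential_family_def)
  have "{(\<lambda>n. of_nat n * shift_monomial F d i n) | i. (\<Sum>j<d. i j) = q} =
      (*) of_nat ` {shift_monomial F d i | i. (\<Sum>j<d. i j) = q}"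
    by (auto simp: times_fun_def)
  then have "W_plus F d q = seq.span (?A ^ q \<union> (*) of_nat ` (?A ^ q))"
    by (simp only: W_plus_def monom)
  \<comment> \<open>Written as a product of sets, the generators allow \<open>?A ^ q\<close> to be
    exchanged for geometric sequences under the span.\<close>
  also have "?A ^ q \<union> (*) of_nat ` (?A ^ q) = {1, of_nat} * ?A ^ q"
    by (force simp: set_times_def)
  also have "seq.span \<dots> = seq.span ({1, of_nat} * geometric ` ?S q)"
    by (intro span_times_cong refl span)
  also have "{1, of_nat} * geometric ` ?S q = exponential_family (?S q) (?S q)"
    by (force simp: set_times_def exponential_family_def)
  finally have Wp: "W_plus F d q = seq.span (exponential_family (?S q) (?S q))" .
  have "W_plus_plus F d p q =
      seq.span (exponential_family (?S p) {} \<union> exponential_family (?S q) (?S q))"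
    unfolding W_plus_plus_def W Wp by (auto simp: seq.span_Un set_plus_def)
  \<comment> \<open>Geometric sequences for common elements of \<open>?S p\<close> and
    \<open>?S q\<close> coincide here; inclusion-exclusion then produces the subtracted
    term.\<close>
  also have "exponential_family (?S p) {} \<union> exponential_family (?S q) (?S q) =
      exponential_family (?S p \<union> ?S q) (?S q)"
    by (auto simp: exponential_family_def)
  finally have Wpp: "W_plus_plus F d p q =
      seq.span (exponential_family (?S p \<union> ?S q) (?S q))" .
  show ?thesis
    unfolding W Wp Wpp
    using card_Un_Int[OF finS[of p] finS[of q]] finS nz
    by (simp add: dim_span_exponential_family del: seq.dim_span)
qed

end
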